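(* Let $G$ be a locally compact group, let $w:G\to\mathbb R$ be an upper semicontinuous function such that $w(x)\ge1$ for each $x\in G$, and let $t\in G$. Let $\phi_t\in\Delta(C_0^w(G))$ be the character $\phi_t(f)=f(t)$, with kernel $\ker(\phi_t)\subseteq C_0^w(G)$. Then the following are equivalent. (1) $\ker(\phi_t)$ has a bounded approximate identity. (2) $\ker(\phi_t)$ has a bounded $\Delta$-weak approximate identity. (3) $C_0^w(G)$ has a bounded $\Delta$-weak approximate identity. (4) $w$ is bounded.
   Context: $C_0^w(G)$ is the space of all continuous functions $f:G\to\mathbb C$ such that $fw$ vanishes at infinity (for every $\epsilon>0$ there is a compact set $K\subseteq G$ with $|f(x)|w(x)<\epsilon$ for all $x\notin K$). With pointwise operations and the norm $\|f\|_w=\sup_{x\in G}|f(x)|w(x)$ it is a commutative Banach algebra. For a Banach algebra $A$, $\Delta(A)$ denotes the set of all non-zero homomorphisms $A\to\mathbb C$. One has $\Delta(C_0^w(G))=\{\phi_x:x\in G\}$, where $\phi_x(f)=f(x)$. A bounded $\Delta$-weak approximate identity for a subspace $E\subseteq A$ (in particular for $E=A$) is a norm-bounded net $(e_\alpha)$ in $E$ such that $\lim_\alpha|\phi(ae_\alpha)-\phi(a)|=0$ for every $a\in E$ and every $\phi\in\Delta(A)$. Here $A=C_0^w(G)$ with norm $\|\cdot\|_w$. A bounded approximate identity for a commutative Banach algebra $B$ is a norm-bounded net $(e_\alpha)$ in $B$ with $\|be_\alpha-b\|\to0$ for every $b\in B$. *)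

theory Defs
  imports "HOL-Analysis.Analysis"
begin

definition upper_semicontinuous :: "('a::topological_space \<Rightarrow> real) \<Rightarrow> bool"
  where "upper_semicontinuous w \<longleftrightarrow> (\<forall>c. open {x. w x < c})"

definition C0w :: "('a::topological_space \<Rightarrow> real) \<Rightarrow> ('a \<Rightarrow> complex) set"
  where "C0w w = {f. continuous_on UNIV f \<and>
    (\<forall>\<epsilon>>0. \<exists>K. compact K \<and> (\<forall>x. x \<notin> K \<longrightarrow> cmod (f x) * w x < \<epsilon>))}"

definition wnorm :: "('a \<Rightarrow> real) \<Rightarrow> ('a \<Rightarrow> complex) \<Rightarrow> real"
  where "wnorm w f = (SUP x. cmod (f x) * w x)"

text \<open>The supremum above ranges over a bounded set when the weight is upper semicontinuous.\<close>

lemma bdd_above_wnorm: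
  fixes w :: "'a::topological_space \<Rightarrow> real"
  assumes usc: "upper_semicontinuous w" and f: "f \<in> C0w w"
  shows "bdd_above (range (\<lambda>x. cmod (f x) * w x))"
proof -
  from f obtain K where K: "compact K" "\<And>x. x \<notin> K \<Longrightarrow> cmod (f x) * w x < 1"
    unfolding C0w_def using zero_less_one by blast
  have cont: "continuous_on K f"
    using f continuous_on_subset unfolding C0w_def by blast
  obtain B where B: "\<And>x. x \<in> K \<Longrightarrow> cmod (f x) \<le> B"
    using compact_imp_bounded[OF compact_continuous_image[OF cont K(1)]]
    unfolding bounded_iff by blast
  have cov: "K \<subseteq> (\<Union>n\<in>UNIV. {x. w x < real n})"
  proof
    fix x
    obtain n where "w x < real n" using reals_Archimedean2 by blast
    then show "x \<in> (\<Union>n\<in>UNIV. {x. w x < real n})" by auto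
  qed
  have op: "open {x. w x < real n}" for n
    using usc unfolding upper_semicontinuous_def by (rule spec)
  obtain N :: "nat set" where N: "finite N" "K \<subseteq> (\<Union>n\<in>N. {x. w x < real n})"
    by (rule compactE_image[OF K(1) op cov]) (rule that)
  have W: "w x \<le> real (Max N)" if "x \<in> K" for x
  proof -
    have "x \<in> (\<Union>n\<in>N. {x. w x < real n})" by (rule subsetD[OF N(2) that])
    then obtain n where n: "n \<in> N" "w x < real n" by blast
    have "n \<le> Max N" using N(1) n(1) by simp
    then have "real n \<le> real (Max N)" by simp
    with n(2) show ?thesis by linarith
  qed
  have "cmod (f x) * w x \<le> max 1 (B * real (Max N))" for x
  proof (cases "x \<in> K")
    case True
    have "cmod (f x) * w x \<le> cmod (f x) * real (Max N)"
      by (rule mult_left_mono[OF W[OF True]]) simp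
    also have "\<dots> \<le> B * real (Max N)"
      by (rule mult_right_mono[OF B[OF True]]) simp
    finally show ?thesis by simp
  next
    case False
    then show ?thesis using K(2)[of x] by linarith
  qed
  then show ?thesis by (intro bdd_aboveI2)
qed

text \<open>In the following, \<open>A\<close>, \<open>B\<close> and \<open>E\<close> are algebras (or subspaces of algebras) of
  complex functions under the pointwise operations, and \<open>N\<close> is a norm on them.\<close>

definition characters :: "('a \<Rightarrow> complex) set \<Rightarrow> (('a \<Rightarrow> complex) \<Rightarrow> complex) set"
  where "characters A = {\<phi>.
    (\<forall>f\<in>A. \<forall>g\<in>A. \<phi> (\<lambda>x. f x + g x) = \<phi> f + \<phi> g) \<and>
    (\<forall>c. \<forall>f\<in>A. \<phi> (\<lambda>x. c * f x) = c * \<phi> f) \<and>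
    (\<forall>f\<in>A. \<forall>g\<in>A. \<phi> (\<lambda>x. f x * g x) = \<phi> f * \<phi> g) \<and>
    (\<exists>f\<in>A. \<phi> f \<noteq> 0)}"

definition evaluation :: "'a \<Rightarrow> ('a \<Rightarrow> complex) \<Rightarrow> complex"
  where "evaluation t = (\<lambda>f. f t)"

definition character_kernel ::
    "('a \<Rightarrow> complex) set \<Rightarrow> (('a \<Rightarrow> complex) \<Rightarrow> complex) \<Rightarrow> ('a \<Rightarrow> complex) set"
  where "character_kernel A \<phi> = {f \<in> A. \<phi> f = 0}"

definition directed_set :: "'i set \<Rightarrow> ('i \<Rightarrow> 'i \<Rightarrow> bool) \<Rightarrow> bool"
  where "directed_set I le \<longleftrightarrow> I \<noteq> {} \<and>
    (\<forall>i\<in>I. le i i) \<and>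
    (\<forall>i\<in>I. \<forall>j\<in>I. \<forall>k\<in>I. le i j \<longrightarrow> le j k \<longrightarrow> le i k) \<and>
    (\<forall>i\<in>I. \<forall>j\<in>I. \<exists>k\<in>I. le i k \<and> le j k)"

definition net_filter :: "'i set \<Rightarrow> ('i \<Rightarrow> 'i \<Rightarrow> bool) \<Rightarrow> 'i filter"
  where "net_filter I le = (INF i\<in>I. principal {j\<in>I. le i j})"

lemma eventually_net_filter:
  assumes "directed_set I le"
  shows "eventually P (net_filter I le) \<longleftrightarrow> (\<exists>i\<in>I. \<forall>j\<in>I. le i j \<longrightarrow> P j)"
proof -
  have "eventually P (net_filter I le) \<longleftrightarrow>
      (\<exists>i\<in>I. eventually P (principal {j\<in>I. le i j}))"
    unfolding net_filter_def
  proof (rule eventually_INF_base)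
    show "I \<noteq> {}" using assms unfolding directed_set_def by blast
    fix i j assume ij: "i \<in> I" "j \<in> I"
    then obtain k where k: "k \<in> I" "le i k" "le j k"
      using assms unfolding directed_set_def by blast
    have "{l\<in>I. le k l} \<subseteq> {l\<in>I. le i l} \<inter> {l\<in>I. le j l}"
      using assms ij k unfolding directed_set_def by blast
    then show "\<exists>l\<in>I. principal {m\<in>I. le l m}
        \<le> inf (principal {m\<in>I. le i m}) (principal {m\<in>I. le j m})"
      using k(1) by auto
  qed
  then show ?thesis by (auto simp: eventually_principal)
qed

definition bounded_approx_identity ::
    "(('a \<Rightarrow> complex) \<Rightarrow> real) \<Rightarrow> ('a \<Rightarrow> complex) set \<Rightarrow>
     'i set \<Rightarrow> ('i \<Rightarrow> 'i \<Rightarrow> bool) \<Rightarrow> ('i \<Rightarrow> 'a \<Rightarrow> complex) \<Rightarrow> bool"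
  where "bounded_approx_identity N B I le e \<longleftrightarrow>
    directed_set I le \<and> (\<forall>i\<in>I. e i \<in> B) \<and> (\<exists>M. \<forall>i\<in>I. N (e i) \<le> M) \<and>
    (\<forall>b\<in>B. ((\<lambda>i. N (\<lambda>x. b x * e i x - b x)) \<longlongrightarrow> 0) (net_filter I le))"

definition bounded_weak_approx_identity ::
    "(('a \<Rightarrow> complex) \<Rightarrow> real) \<Rightarrow> ('a \<Rightarrow> complex) set \<Rightarrow> ('a \<Rightarrow> complex) set \<Rightarrow>
     'i set \<Rightarrow> ('i \<Rightarrow> 'i \<Rightarrow> bool) \<Rightarrow> ('i \<Rightarrow> 'a \<Rightarrow> complex) \<Rightarrow> bool"
  where "bounded_weak_approx_identity N A E I le e \<longleftrightarrow>
    directed_set I le \<and> (\<forall>i\<in>I. e i \<in> E) \<and> (\<exists>M. \<forall>i\<in>I. N (e i) \<le> M) \<and>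
    (\<forall>a\<in>E. \<forall>\<phi>\<in>characters A.
      ((\<lambda>i. cmod (\<phi> (\<lambda>x. a x * e i x) - \<phi> a)) \<longlongrightarrow> 0) (net_filter I le))"

text \<open>HOL cannot quantify existentially over the index type of a net. A net of functions can
  however always be reindexed by pairs consisting of a tail of the net and an element of that tail,
  so a fixed index type suffices; see the two introduction rules below, in which the index type
  \<open>'i\<close> is arbitrary.\<close>

type_synonym 'a fun_net_index = "('a \<Rightarrow> complex) set \<times> ('a \<Rightarrow> complex)"

definition has_bounded_approx_identity ::
    "(('a \<Rightarrow> complex) \<Rightarrow> real) \<Rightarrow> ('a \<Rightarrow> complex) set \<Rightarrow> bool"
  where "has_bounded_approx_identity N B \<longleftrightarrow>
    (\<exists>(I :: 'a fun_net_index set) le e. bounded_approx_identity N B I le e)"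

definition has_bounded_weak_approx_identity ::
    "(('a \<Rightarrow> complex) \<Rightarrow> real) \<Rightarrow> ('a \<Rightarrow> complex) set \<Rightarrow> ('a \<Rightarrow> complex) set \<Rightarrow> bool"
  where "has_bounded_weak_approx_identity N A E \<longleftrightarrow>
    (\<exists>(I :: 'a fun_net_index set) le e. bounded_weak_approx_identity N A E I le e)"

lemma net_reindex:
  fixes I :: "'i set" and e :: "'i \<Rightarrow> 'b"
  assumes dir: "directed_set I le"
  obtains J :: "('b set \<times> 'b) set" and le' and e' where
    "directed_set J le'" "e' ` J \<subseteq> e ` I"
    "\<And>P. eventually (\<lambda>i. P (e i)) (net_filter I le) \<Longrightarrow>
      eventually (\<lambda>j. P (e' j)) (net_filter J le')"
proof -
  define T where "T i = e ` {j\<in>I. le i j}" for i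
  define J where "J = {(S, f). \<exists>i\<in>I. S = T i \<and> f \<in> S}"
  define le' :: "('b set \<times> 'b) \<Rightarrow> ('b set \<times> 'b) \<Rightarrow> bool"
    where "le' p q \<longleftrightarrow> fst q \<subseteq> fst p" for p q
  have mem: "(T i, e i) \<in> J" if "i \<in> I" for i
    using that dir unfolding J_def T_def directed_set_def by blast
  have ub: "\<exists>r\<in>J. le' p r \<and> le' q r" if pq: "p \<in> J" "q \<in> J" for p q
  proof -
    obtain i j where ij: "i \<in> I" "j \<in> I" "fst p = T i" "fst q = T j"
      using pq unfolding J_def by auto
    then obtain k where k: "k \<in> I" "le i k" "le j k"
      using dir unfolding directed_set_def by blast
    have "T k \<subseteq> T i" "T k \<subseteq> T j"
      using dir ij k unfolding T_def directed_set_def by blast+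
    then show ?thesis
      using mem[OF k(1)] ij unfolding le'_def by (intro bexI[of _ "(T k, e k)"]) auto
  qed
  have "I \<noteq> {}" using dir unfolding directed_set_def by blast
  then have "J \<noteq> {}" using mem by blast
  then have dirJ: "directed_set J le'"
    using ub unfolding directed_set_def by (auto simp: le'_def)
  have img: "snd ` J \<subseteq> e ` I" unfolding J_def T_def by auto
  have ev: "eventually (\<lambda>j. P (snd j)) (net_filter J le')"
    if P: "eventually (\<lambda>i. P (e i)) (net_filter I le)" for P
  proof -
    obtain i where i: "i \<in> I" "\<And>j. j \<in> I \<Longrightarrow> le i j \<Longrightarrow> P (e j)"
      using P unfolding eventually_net_filter[OF dir] by blast
    have "P (snd q)" if q: "q \<in> J" "le' (T i, e i) q" for q
    proof -
      have "snd q \<in> fst q" using q(1) unfolding J_def by auto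
      then have "snd q \<in> T i" using q(2) unfolding le'_def by auto
      then show ?thesis using i(2) unfolding T_def by auto
    qed
    then show ?thesis
      unfolding eventually_net_filter[OF dirJ] using mem[OF i(1)] by blast
  qed
  show ?thesis by (rule that[OF dirJ img ev])
qed

lemma has_bounded_approx_identityI:
  fixes I :: "'i set"
  assumes "bounded_approx_identity N B I le e"
  shows "has_bounded_approx_identity N B"
proof -
  have dir: "directed_set I le" using assms unfolding bounded_approx_identity_def by blast
  obtain J :: "'a fun_net_index set" and le' e' where J: "directed_set J le'" "e' ` J \<subseteq> e ` I"
    and ev: "\<And>P. eventually (\<lambda>i. P (e i)) (net_filter I le) \<Longrightarrow>
      eventually (\<lambda>j. P (e' j)) (net_filter J le')"
    by (rule net_reindex[OF dir, of e]) (rule that)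
  have conv: "((\<lambda>j. N (\<lambda>x. b x * e' j x - b x)) \<longlongrightarrow> 0) (net_filter J le')" if "b \<in> B" for b
  proof -
    have lim: "((\<lambda>i. N (\<lambda>x. b x * e i x - b x)) \<longlongrightarrow> 0) (net_filter I le)"
      using assms that unfolding bounded_approx_identity_def by blast
    show ?thesis
      by (rule topological_tendstoI,
          rule ev[of "\<lambda>h. N (\<lambda>x. b x * h x - b x) \<in> S" for S],
          rule topological_tendstoD[OF lim])
  qed
  have im: "e' j \<in> e ` I" if "j \<in> J" for j
    by (rule subsetD[OF J(2)]) (rule imageI[OF that])
  have eB: "e i \<in> B" if "i \<in> I" for i
    using assms that unfolding bounded_approx_identity_def by blast
  obtain M where M: "\<And>i. i \<in> I \<Longrightarrow> N (e i) \<le> M"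
    using assms unfolding bounded_approx_identity_def by blast
  have B': "\<forall>j\<in>J. e' j \<in> B"
  proof
    fix j assume "j \<in> J"
    from im[OF this] obtain i where "i \<in> I" "e' j = e i" by (rule imageE)
    then show "e' j \<in> B" using eB by simp
  qed
  have M': "\<forall>j\<in>J. N (e' j) \<le> M"
  proof
    fix j assume "j \<in> J"
    from im[OF this] obtain i where "i \<in> I" "e' j = e i" by (rule imageE)
    then show "N (e' j) \<le> M" using M by simp
  qed
  have "bounded_approx_identity N B J le' e'"
    unfolding bounded_approx_identity_def
    by (intro conjI ballI exI[of _ M] J(1) conv) (simp_all add: B' M')
  then show ?thesis unfolding has_bounded_approx_identity_def by (intro exI)
qed

lemma has_bounded_weak_approx_identityI:
  fixes I :: "'i set"
  assumes "bounded_weak_approx_identity N A E I le e"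
  shows "has_bounded_weak_approx_identity N A E"
proof -
  have dir: "directed_set I le" using assms unfolding bounded_weak_approx_identity_def by blast
  obtain J :: "'a fun_net_index set" and le' e' where J: "directed_set J le'" "e' ` J \<subseteq> e ` I"
    and ev: "\<And>P. eventually (\<lambda>i. P (e i)) (net_filter I le) \<Longrightarrow>
      eventually (\<lambda>j. P (e' j)) (net_filter J le')"
    by (rule net_reindex[OF dir, of e]) (rule that)
  have conv: "((\<lambda>j. cmod (\<phi> (\<lambda>x. a x * e' j x) - \<phi> a)) \<longlongrightarrow> 0) (net_filter J le')"
    if "a \<in> E" "\<phi> \<in> characters A" for a \<phi>
  proof -
    have lim: "((\<lambda>i. cmod (\<phi> (\<lambda>x. a x * e i x) - \<phi> a)) \<longlongrightarrow> 0) (net_filter I le)"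
      using assms that unfolding bounded_weak_approx_identity_def by blast
    show ?thesis
      by (rule topological_tendstoI,
          rule ev[of "\<lambda>h. cmod (\<phi> (\<lambda>x. a x * h x) - \<phi> a) \<in> S" for S],
          rule topological_tendstoD[OF lim])
  qed
  have im: "e' j \<in> e ` I" if "j \<in> J" for j
    by (rule subsetD[OF J(2)]) (rule imageI[OF that])
  have eB: "e i \<in> E" if "i \<in> I" for i
    using assms that unfolding bounded_weak_approx_identity_def by blast
  obtain M where M: "\<And>i. i \<in> I \<Longrightarrow> N (e i) \<le> M"
    using assms unfolding bounded_weak_approx_identity_def by blast
  have B': "\<forall>j\<in>J. e' j \<in> E"
  proof
    fix j assume "j \<in> J"
    from im[OF this] obtain i where "i \<in> I" "e' j = e i" by (rule imageE)
    then show "e' j \<in> E" using eB by simp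
  qed
  have M': "\<forall>j\<in>J. N (e' j) \<le> M"
  proof
    fix j assume "j \<in> J"
    from im[OF this] obtain i where "i \<in> I" "e' j = e i" by (rule imageE)
    then show "N (e' j) \<le> M" using M by simp
  qed
  have "bounded_weak_approx_identity N A E J le' e'"
    unfolding bounded_weak_approx_identity_def
    by (intro conjI ballI exI[of _ M] J(1) conv) (simp_all add: B' M')
  then show ?thesis unfolding has_bounded_weak_approx_identity_def by (intro exI)
qed

end

theory Submission
  imports Defs
begin

text \<open>
  Everything rests on the pointwise bound \<open>cmod (f x) * w x \<le> wnorm w f\<close> and on characters being
  contractive.

  If a subspace has a bounded weak approximate identity \<open>e\<close> and some member of it does not vanish
  at \<open>x\<close>, then testing against evaluation at \<open>x\<close> forces \<open>e\<^sub>i(x) \<rightarrow> 1\<close>, so that \<open>w(x)\<close> is at most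
  the norm bound of \<open>e\<close> (\<open>bounded_weak_approx_identity_weight_le\<close>). In a locally compact Hausdorff
  space bump functions (\<open>C0w_bump\<close>) show that such a member exists for every \<open>x\<close> in the full
  algebra, and for every \<open>x \<noteq> t\<close> in the kernel of evaluation at \<open>t\<close>.
  The remaining value \<open>w(t)\<close> is just one number, so \<open>w\<close> is bounded in either case.

  Conversely let \<open>w\<close> be bounded, and let \<open>E\<close> be the algebra or the kernel. For a finite set of
  members \<open>f\<^sub>1, \<dots>, f\<^sub>k\<close> of \<open>E\<close> put \<open>h = \<Sum> \<bar>f\<^sub>j\<bar>\<^sup>2\<close>. For \<open>\<delta> > 0\<close> the function \<open>h / (h + \<delta>)\<close> lies in
  \<open>E\<close> again, because it is dominated by \<open>h / \<delta>\<close>. Its values are in \<open>[0, 1]\<close>, and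
  \<open>\<bar>f\<^sub>j\<bar> * \<bar>1 - h / (h + \<delta>)\<bar> \<le> sqrt \<delta>\<close>. A bounded weight turns these two uniform bounds into bounds for
  \<open>wnorm w\<close>, so that these functions, indexed by the finite sets and by \<open>\<delta>\<close>, form a bounded
  approximate identity for \<open>E\<close> (\<open>bounded_weight_imp_has_bounded_approx_identity\<close>).

  An approximate identity is a weak one because a character \<open>\<phi>\<close> is contractive
  (\<open>character_contractive\<close>): \<open>\<phi> f = 1\<close> is
  impossible when \<open>wnorm w f < 1\<close>, since then \<open>1 - f\<close> is bounded away from zero and the element
  \<open>g = f / (1 - f)\<close> of the algebra satisfies \<open>g = f + f * g\<close>, which \<open>\<phi>\<close> would map to
  \<open>\<phi> g = 1 + \<phi> g\<close>.
\<close>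

section \<open>The weighted function algebra\<close>

lemma C0wI_vanishing:
  assumes "continuous_on UNIV f"
    and "\<And>\<epsilon>. \<epsilon> > 0 \<Longrightarrow> \<exists>K. compact K \<and> (\<forall>x. x \<notin> K \<longrightarrow> cmod (f x) * w x < \<epsilon>)"
  shows "f \<in> C0w w"
  using assms unfolding C0w_def by blast

lemma C0w_continuous: "f \<in> C0w w \<Longrightarrow> continuous_on UNIV f"
  unfolding C0w_def by blast

lemma C0w_vanishes:
  assumes "f \<in> C0w w" "\<epsilon> > 0"
  obtains K where "compact K" "\<And>x. x \<notin> K \<Longrightarrow> cmod (f x) * w x < \<epsilon>"
  using assms unfolding C0w_def by blast

text \<open>
  Membership in the algebra is usually shown by domination: a continuous function inherits the decay
  of any member that bounds it up to a constant. The proof replaces \<open>C\<close> by \<open>\<bar>C\<bar> + 1\<close> in order to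
  divide by it.
\<close>

lemma C0w_dominated:
  assumes f: "f \<in> C0w w" and g: "continuous_on UNIV g"
    and C: "\<And>x. cmod (g x) \<le> C * cmod (f x)" and w: "\<And>x. w x \<ge> 1"
  shows "g \<in> C0w w"
proof (rule C0wI_vanishing[OF g])
  fix \<epsilon> :: real assume "\<epsilon> > 0"
  then have "0 < \<epsilon> / (\<bar>C\<bar> + 1)" by simp
  then obtain K where K: "compact K" "\<And>x. x \<notin> K \<Longrightarrow> cmod (f x) * w x < \<epsilon> / (\<bar>C\<bar> + 1)"
    by (rule C0w_vanishes[OF f]) (rule that)
  have "cmod (g x) * w x < \<epsilon>" if "x \<notin> K" for x
  proof -
    have w0: "0 \<le> w x" using w[of x] by simp
    have "cmod (g x) \<le> (\<bar>C\<bar> + 1) * cmod (f x)"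
      by (rule order_trans[OF C]) (simp add: mult_right_mono)
    then have "cmod (g x) * w x \<le> (\<bar>C\<bar> + 1) * (cmod (f x) * w x)"
      using mult_right_mono[OF _ w0] by (fastforce simp: mult.assoc)
    also have "\<dots> < \<epsilon>"
      using K(2)[OF that] by (simp add: pos_less_divide_eq mult.commute)
    finally show ?thesis .
  qed
  then show "\<exists>K. compact K \<and> (\<forall>x. x \<notin> K \<longrightarrow> cmod (g x) * w x < \<epsilon>)"
    using K(1) by blast
qed

lemma C0w_add:
  assumes f: "f \<in> C0w w" and g: "g \<in> C0w w" and w: "\<And>x. w x \<ge> 1"
  shows "(\<lambda>x. f x + g x) \<in> C0w w"
proof (rule C0wI_vanishing)
  show "continuous_on UNIV (\<lambda>x. f x + g x)"
    by (intro continuous_intros C0w_continuous[OF f] C0w_continuous[OF g])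
  fix \<epsilon> :: real assume e: "\<epsilon> > 0"
  obtain K where K: "compact K" "\<And>x. x \<notin> K \<Longrightarrow> cmod (f x) * w x < \<epsilon> / 2"
    by (rule C0w_vanishes[OF f, of "\<epsilon> / 2"]) (use e in auto)
  obtain L where L: "compact L" "\<And>x. x \<notin> L \<Longrightarrow> cmod (g x) * w x < \<epsilon> / 2"
    by (rule C0w_vanishes[OF g, of "\<epsilon> / 2"]) (use e in auto)
  have "cmod (f x + g x) * w x < \<epsilon>" if "x \<notin> K \<union> L" for x
  proof -
    have "cmod (f x + g x) * w x \<le> (cmod (f x) + cmod (g x)) * w x"
      using w[of x] by (intro mult_right_mono norm_triangle_ineq) simp
    also have "\<dots> < \<epsilon>"
      using K(2)[of x] L(2)[of x] that by (simp add: distrib_right)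
    finally show ?thesis .
  qed
  then show "\<exists>K. compact K \<and> (\<forall>x. x \<notin> K \<longrightarrow> cmod (f x + g x) * w x < \<epsilon>)"
    using compact_Un[OF K(1) L(1)] by blast
qed

lemma C0w_cmult:
  assumes f: "f \<in> C0w w" and w: "\<And>x. w x \<ge> 1"
  shows "(\<lambda>x. c * f x) \<in> C0w w"
  by (rule C0w_dominated[OF f _ _ w, where C = "cmod c"])
    (auto simp: norm_mult intro!: continuous_intros C0w_continuous[OF f])

lemma C0w_diff:
  assumes f: "f \<in> C0w w" and g: "g \<in> C0w w" and w: "\<And>x. w x \<ge> 1"
  shows "(\<lambda>x. f x - g x) \<in> C0w w"
  using C0w_add[OF f C0w_cmult[OF g w, of "- 1"] w] by simp

lemma wnorm_ge:
  assumes "upper_semicontinuous w" "f \<in> C0w w"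
  shows "cmod (f x) * w x \<le> wnorm w f"
  unfolding wnorm_def by (rule cSUP_upper[OF _ bdd_above_wnorm[OF assms]]) simp

lemma C0w_norm_le_wnorm:
  assumes "upper_semicontinuous w" "f \<in> C0w w" and w: "\<And>x. w x \<ge> 1"
  shows "cmod (f x) \<le> wnorm w f"
  using wnorm_ge[OF assms(1,2), of x] mult_left_mono[OF w, of "cmod (f x)" x] by simp

lemma wnorm_le:
  assumes "\<And>x. cmod (f x) * w x \<le> B"
  shows "wnorm w f \<le> B"
  unfolding wnorm_def by (rule cSUP_least) (use assms in auto)

lemma C0w_mult:
  assumes usc: "upper_semicontinuous w" and f: "f \<in> C0w w" and g: "g \<in> C0w w"
    and w: "\<And>x. w x \<ge> 1"
  shows "(\<lambda>x. f x * g x) \<in> C0w w"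
  by (rule C0w_dominated[OF g _ _ w, where C = "wnorm w f"])
    (auto simp: norm_mult intro!: mult_right_mono C0w_norm_le_wnorm[OF usc f w]
      continuous_intros C0w_continuous[OF f] C0w_continuous[OF g])

section \<open>Characters are contractive\<close>

lemma character_add:
  assumes "\<phi> \<in> characters A" "f \<in> A" "g \<in> A"
  shows "\<phi> (\<lambda>x. f x + g x) = \<phi> f + \<phi> g"
  using assms unfolding characters_def by blast

lemma character_mult:
  assumes "\<phi> \<in> characters A" "f \<in> A" "g \<in> A"
  shows "\<phi> (\<lambda>x. f x * g x) = \<phi> f * \<phi> g"
  using assms unfolding characters_def by blast

lemma character_cmult:
  assumes "\<phi> \<in> characters A" "f \<in> A"
  shows "\<phi> (\<lambda>x. c * f x) = c * \<phi> f"
  using assms unfolding characters_def by blast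

text \<open>
  Continuity of characters is automatic, for an algebraic reason: every element \<open>f\<close> of the open unit
  ball has the quasi-inverse \<open>f / (1 - f)\<close>, a multiple of \<open>f\<close> by a bounded continuous function.
\<close>

lemma character_ne_one:
  assumes usc: "upper_semicontinuous w" and w: "\<And>x. w x \<ge> 1"
    and \<phi>: "\<phi> \<in> characters (C0w w)" and f: "f \<in> C0w w" and lt: "wnorm w f < 1"
  shows "\<phi> f \<noteq> 1"
proof
  assume one: "\<phi> f = 1"
  define g where "g x = f x / (1 - f x)" for x
  have away: "1 - wnorm w f \<le> cmod (1 - f x)" for x
    using norm_triangle_ineq2[of 1 "f x"] C0w_norm_le_wnorm[OF usc f w, of x] by simp
  have nz: "1 - f x \<noteq> 0" for x
    using away[of x] lt by auto
  have "cmod (g x) \<le> inverse (1 - wnorm w f) * cmod (f x)" for x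
  proof -
    have "cmod (g x) = inverse (cmod (1 - f x)) * cmod (f x)"
      by (simp add: g_def norm_divide divide_inverse[of "cmod _"] mult.commute)
    also have "\<dots> \<le> inverse (1 - wnorm w f) * cmod (f x)"
      using away[of x] lt by (intro mult_right_mono le_imp_inverse_le) auto
    finally show ?thesis .
  qed
  moreover have "continuous_on UNIV g"
    unfolding g_def using nz by (intro continuous_intros C0w_continuous[OF f]) auto
  ultimately have g: "g \<in> C0w w"
    using C0w_dominated[OF f _ _ w] by blast
  have "g = (\<lambda>x. f x + f x * g x)"
    unfolding g_def using nz by (auto simp: field_simps)
  then have "\<phi> g = \<phi> (\<lambda>x. f x + f x * g x)" by simp
  also have "\<dots> = \<phi> f + \<phi> (\<lambda>x. f x * g x)"
    by (rule character_add[OF \<phi> f C0w_mult[OF usc f g w]])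
  also have "\<dots> = \<phi> f + \<phi> f * \<phi> g"
    by (simp only: character_mult[OF \<phi> f g])
  finally show False using one by simp
qed

lemma character_contractive:
  assumes usc: "upper_semicontinuous w" and w: "\<And>x. w x \<ge> 1"
    and \<phi>: "\<phi> \<in> characters (C0w w)" and f: "f \<in> C0w w"
  shows "cmod (\<phi> f) \<le> wnorm w f"
proof (rule ccontr)
  assume "\<not> ?thesis"
  then have gt: "wnorm w f < cmod (\<phi> f)" by simp
  have "0 \<le> wnorm w f"
    using C0w_norm_le_wnorm[OF usc f w] norm_ge_zero order_trans by blast
  then have nz: "\<phi> f \<noteq> 0" using gt by auto
  define g where "g x = inverse (\<phi> f) * f x" for x
  have g: "g \<in> C0w w" unfolding g_def by (rule C0w_cmult[OF f w])
  have "cmod (g x) * w x \<le> wnorm w f / cmod (\<phi> f)" for x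
    using divide_right_mono[OF wnorm_ge[OF usc f, of x], of "cmod (\<phi> f)"]
    by (simp add: g_def norm_mult norm_inverse divide_inverse ac_simps)
  then have "wnorm w g \<le> wnorm w f / cmod (\<phi> f)" by (rule wnorm_le)
  also have "\<dots> < 1" using gt nz by simp
  finally have "\<phi> g \<noteq> 1" by (rule character_ne_one[OF usc w \<phi> g])
  moreover have "\<phi> g = inverse (\<phi> f) * \<phi> f"
    unfolding g_def by (rule character_cmult[OF \<phi> f])
  ultimately show False using nz by simp
qed

lemma bounded_approx_identity_imp_weak:
  assumes usc: "upper_semicontinuous w" and w: "\<And>x. w x \<ge> 1" and E: "E \<subseteq> C0w w"
    and bai: "bounded_approx_identity (wnorm w) E I le e"
  shows "bounded_weak_approx_identity (wnorm w) (C0w w) E I le e"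
proof -
  have dir: "directed_set I le" and eE: "\<And>i. i \<in> I \<Longrightarrow> e i \<in> E"
    using bai unfolding bounded_approx_identity_def by auto
  have "((\<lambda>i. cmod (\<phi> (\<lambda>x. a x * e i x) - \<phi> a)) \<longlongrightarrow> 0) (net_filter I le)"
    if a: "a \<in> E" and \<phi>: "\<phi> \<in> characters (C0w w)" for a \<phi>
  proof (rule Lim_null_comparison)
    show "((\<lambda>i. wnorm w (\<lambda>x. a x * e i x - a x)) \<longlongrightarrow> 0) (net_filter I le)"
      using bai a unfolding bounded_approx_identity_def by blast
    have "norm (cmod (\<phi> (\<lambda>x. a x * e i x) - \<phi> a)) \<le> wnorm w (\<lambda>x. a x * e i x - a x)"
      if i: "i \<in> I" for i
    proof -
      have a': "a \<in> C0w w" and e': "e i \<in> C0w w" using a eE[OF i] E by auto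
      have ae: "(\<lambda>x. a x * e i x) \<in> C0w w" by (rule C0w_mult[OF usc a' e' w])
      have d: "(\<lambda>x. a x * e i x - a x) \<in> C0w w" by (rule C0w_diff[OF ae a' w])
      have "\<phi> (\<lambda>x. (a x * e i x - a x) + a x) = \<phi> (\<lambda>x. a x * e i x - a x) + \<phi> a"
        by (rule character_add[OF \<phi> d a'])
      then show ?thesis using character_contractive[OF usc w \<phi> d] by simp
    qed
    moreover obtain i where "i \<in> I" using dir unfolding directed_set_def by blast
    ultimately show "\<forall>\<^sub>F i in net_filter I le.
        norm (cmod (\<phi> (\<lambda>x. a x * e i x) - \<phi> a)) \<le> wnorm w (\<lambda>x. a x * e i x - a x)"
      unfolding eventually_net_filter[OF dir] by blast
  qed
  then show ?thesis
    using bai unfolding bounded_approx_identity_def bounded_weak_approx_identity_def by blast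
qed

section \<open>Approximate identities for a bounded weight\<close>

definition sum_of_squares :: "('a \<Rightarrow> complex) set \<Rightarrow> 'a \<Rightarrow> real"
  where "sum_of_squares F x = (\<Sum>f\<in>F. (cmod (f x))\<^sup>2)"

lemma sum_of_squares_nonneg: "0 \<le> sum_of_squares F x"
  unfolding sum_of_squares_def by (intro sum_nonneg) auto

lemma sum_of_squares_C0w:
  assumes usc: "upper_semicontinuous w" and w: "\<And>x. w x \<ge> 1"
    and F: "finite F" "F \<subseteq> C0w w"
  shows "(\<lambda>x. of_real (sum_of_squares F x)) \<in> C0w w"
  using F
proof (induction F rule: finite_induct)
  case empty
  show ?case
    by (rule C0wI_vanishing) (auto simp: sum_of_squares_def intro: exI[of _ "{}"])
next
  case (insert f F)
  have f: "f \<in> C0w w" using insert by simp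
  have "(\<lambda>x. of_real ((cmod (f x))\<^sup>2)) \<in> C0w w"
  proof (rule C0w_dominated[OF f _ _ w, where C = "wnorm w f"])
    show "continuous_on UNIV (\<lambda>x. complex_of_real ((cmod (f x))\<^sup>2))"
      by (intro continuous_intros C0w_continuous[OF f])
    show "cmod (complex_of_real ((cmod (f x))\<^sup>2)) \<le> wnorm w f * cmod (f x)" for x
      using C0w_norm_le_wnorm[OF usc f w, of x]
      by (simp only: norm_of_real) (simp add: power2_eq_square mult_right_mono)
  qed
  then show ?case
    using C0w_add[OF _ _ w] insert by (auto simp: sum_of_squares_def)
qed

text \<open>
  The factor \<open>\<delta> / (h + \<delta>)\<close> is \<open>1 - h / (h + \<delta>)\<close>; since \<open>h \<ge> r\<^sup>2\<close>, the bound comes from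
  \<open>r * sqrt \<delta> \<le> r\<^sup>2 + \<delta>\<close>.
\<close>

lemma mult_resolvent_le_sqrt:
  fixes r h \<delta> :: real
  assumes "0 \<le> r" "r\<^sup>2 \<le> h" "0 < \<delta>"
  shows "r * (\<delta> / (h + \<delta>)) \<le> sqrt \<delta>"
proof -
  define s where "s = sqrt \<delta>"
  have s: "0 < s" "\<delta> = s\<^sup>2" using assms(3) by (auto simp: s_def)
  have pos: "0 < h + \<delta>" using assms by (smt (verit) zero_le_power2)
  have "r * s \<le> r\<^sup>2 + s\<^sup>2"
  proof -
    have "0 \<le> (r - s)\<^sup>2" "0 \<le> r * s" using assms(1) s(1) by simp_all
    then show ?thesis unfolding power2_diff by linarith
  qed
  then have "r * s \<le> h + \<delta>" using assms(2) s(2) by linarith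
  then have "s * (r * s) \<le> s * (h + \<delta>)" using s(1) by (intro mult_left_mono) auto
  then have "r * \<delta> \<le> s * (h + \<delta>)" unfolding s(2) by (simp add: power2_eq_square ac_simps)
  then show ?thesis using pos by (simp add: pos_divide_le_eq s_def)
qed

text \<open>
  Hypothesis \<open>hull\<close> describes ideals given by vanishing conditions: a member of the algebra belongs
  to \<open>E\<close> as soon as it vanishes at the common zeros of finitely many members of \<open>E\<close>. The algebra
  itself and the kernel of an evaluation have this property, and \<open>h / (h + \<delta>)\<close> vanishes exactly
  where the functions that enter into \<open>h\<close> all vanish. The set \<open>F\<close> may be empty, and then \<open>h = 0\<close>.
\<close>

lemma bounded_weight_imp_has_bounded_approx_identity:
  fixes w :: "'a::topological_space \<Rightarrow> real"
  assumes usc: "upper_semicontinuous w" and w: "\<And>x. w x \<ge> 1" and E: "E \<subseteq> C0w w"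
    and hull: "\<And>F g. finite F \<Longrightarrow> F \<subseteq> E \<Longrightarrow> g \<in> C0w w \<Longrightarrow>
      (\<And>x. (\<forall>f\<in>F. f x = 0) \<Longrightarrow> g x = 0) \<Longrightarrow> g \<in> E"
    and bdd: "bounded (range w)"
  shows "has_bounded_approx_identity (wnorm w) E"
proof -
  define I :: "(('a \<Rightarrow> complex) set \<times> nat) set"
    where "I = {F. finite F \<and> F \<subseteq> E} \<times> UNIV"
  define le where "le p q \<longleftrightarrow> fst p \<subseteq> fst q \<and> snd p \<le> snd q"
    for p q :: "('a \<Rightarrow> complex) set \<times> nat"
  define \<delta> :: "nat \<Rightarrow> real" where "\<delta> n = inverse (real (Suc n))" for n
  define e :: "('a \<Rightarrow> complex) set \<times> nat \<Rightarrow> 'a \<Rightarrow> complex"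
    where "e p x = of_real (sum_of_squares (fst p) x / (sum_of_squares (fst p) x + \<delta> (snd p)))"
    for p x
  have \<delta>: "\<delta> n > 0" for n unfolding \<delta>_def by simp
  have hpos: "sum_of_squares F x + \<delta> n > 0" for F :: "('a \<Rightarrow> complex) set" and x n
    using sum_of_squares_nonneg[of F x] \<delta>[of n] by linarith
  obtain W where W: "\<And>x. w x \<le> W"
    using bdd unfolding bounded_iff by (auto dest: abs_le_D1)
  have W0: "0 < W" using w[of undefined] W[of undefined] by linarith
  have dir: "directed_set I le"
    unfolding directed_set_def
  proof (intro conjI ballI impI)
    show "I \<noteq> {}" unfolding I_def by auto
    fix p q assume pq: "p \<in> I" "q \<in> I"
    show "\<exists>r\<in>I. le p r \<and> le q r"
      by (rule bexI[of _ "(fst p \<union> fst q, max (snd p) (snd q))"])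
        (use pq in \<open>auto simp: I_def le_def\<close>)
  qed (auto simp: le_def)
  have eE: "e p \<in> E" if p: "p \<in> I" for p
  proof (rule hull[of "fst p"])
    show F: "finite (fst p)" "fst p \<subseteq> E" using p unfolding I_def by auto
    have S: "(\<lambda>x. of_real (sum_of_squares (fst p) x)) \<in> C0w w"
      by (rule sum_of_squares_C0w[OF usc w F(1)]) (use F E in auto)
    \<comment> \<open>The real part recovers continuity of the real function from that of its complex embedding.\<close>
    have "continuous_on UNIV (\<lambda>x. Re (of_real (sum_of_squares (fst p) x)))"
      by (intro continuous_intros C0w_continuous[OF S])
    then have cont: "continuous_on UNIV (sum_of_squares (fst p))" by simp
    show "e p \<in> C0w w"
    proof (rule C0w_dominated[OF S _ _ w])
      have nz: "sum_of_squares (fst p) x + \<delta> (snd p) \<noteq> 0" for x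
        using hpos[of "fst p" x "snd p"] by linarith
      have "continuous_on UNIV (\<lambda>x. sum_of_squares (fst p) x / (sum_of_squares (fst p) x + \<delta> (snd p)))"
        by (intro continuous_intros cont ballI nz)
      then show "continuous_on UNIV (e p)"
        unfolding e_def by (intro continuous_on_of_real)
      show "cmod (e p x) \<le> inverse (\<delta> (snd p)) * cmod (of_real (sum_of_squares (fst p) x))" for x
      proof -
        have "cmod (e p x) = inverse (sum_of_squares (fst p) x + \<delta> (snd p)) * sum_of_squares (fst p) x"
          unfolding e_def norm_of_real using hpos[of "fst p" x "snd p"] sum_of_squares_nonneg[of "fst p" x]
          by (simp add: divide_inverse mult.commute)
        also have "\<dots> \<le> inverse (\<delta> (snd p)) * sum_of_squares (fst p) x"
          using \<delta> sum_of_squares_nonneg[of "fst p" x]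
          by (intro mult_right_mono le_imp_inverse_le) auto
        finally show ?thesis using sum_of_squares_nonneg[of "fst p" x] by simp
      qed
    qed
    show "e p x = 0" if "\<forall>f\<in>fst p. f x = 0" for x
    proof -
      have "sum_of_squares (fst p) x = 0" using that unfolding sum_of_squares_def by (intro sum.neutral) auto
      then show ?thesis by (simp only: e_def) simp
    qed
  qed
  have e1: "cmod (e p x) \<le> 1" for p x
    unfolding e_def norm_of_real
    using hpos[of "fst p" x "snd p"] sum_of_squares_nonneg[of "fst p" x] \<delta>[of "snd p"] by simp
  have bound: "wnorm w (e p) \<le> W" for p
    by (rule wnorm_le) (use mult_mono[OF e1 W] w W0 in \<open>smt (verit)\<close>)
  have conv: "((\<lambda>p. wnorm w (\<lambda>x. b x * e p x - b x)) \<longlongrightarrow> 0) (net_filter I le)"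
    if b: "b \<in> E" for b
  proof (rule Lim_null_comparison)
    have err: "wnorm w (\<lambda>x. b x * e p x - b x) \<le> sqrt (\<delta> (snd p)) * W"
      if p: "p \<in> I" "b \<in> fst p" for p
    proof (rule wnorm_le)
      fix x
      let ?h = "sum_of_squares (fst p) x" and ?d = "\<delta> (snd p)"
      have "finite (fst p)" using p unfolding I_def by auto
      then have h: "(cmod (b x))\<^sup>2 \<le> ?h"
        unfolding sum_of_squares_def using p(2) by (intro member_le_sum) auto
      have complement: "?h / (?h + ?d) = 1 - ?d / (?h + ?d)"
        using hpos[of "fst p" x "snd p"] by (simp add: field_simps)
      have "e p x - 1 = - of_real (?d / (?h + ?d))"
        unfolding e_def complement by simp
      moreover have "b x * e p x - b x = b x * (e p x - 1)" by (simp add: algebra_simps)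
      ultimately have "cmod (b x * e p x - b x) = cmod (b x) * (?d / (?h + ?d))"
        using hpos[of "fst p" x "snd p"] \<delta>[of "snd p"]
        by (simp only: norm_mult norm_minus_cancel norm_of_real) simp
      also have "\<dots> \<le> sqrt ?d"
        by (rule mult_resolvent_le_sqrt[OF norm_ge_zero h \<delta>])
      finally show "cmod (b x * e p x - b x) * w x \<le> sqrt ?d * W"
        using W[of x] w[of x] \<delta>[of "snd p"] by (intro mult_mono) auto
    qed
    have nonneg: "0 \<le> wnorm w (\<lambda>x. b x * e p x - b x)" if p: "p \<in> I" for p
    proof -
      have b': "b \<in> C0w w" and e': "e p \<in> C0w w" using b eE[OF p] E by auto
      have "(\<lambda>x. b x * e p x - b x) \<in> C0w w"
        by (rule C0w_diff[OF C0w_mult[OF usc b' e' w] b' w])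
      from C0w_norm_le_wnorm[OF usc this w] show ?thesis
        using norm_ge_zero order_trans by blast
    qed
    \<comment> \<open>The error estimate applies from this index on, because all later finite sets contain \<open>b\<close>.\<close>
    have i: "({b}, 0) \<in> I" using b by (simp add: I_def)
    have "norm (wnorm w (\<lambda>x. b x * e p x - b x)) \<le> sqrt (\<delta> (snd p)) * W"
      if "p \<in> I" "le ({b}, 0) p" for p
      using err[OF that(1)] nonneg[OF that(1)] that(2) by (simp add: le_def)
    then show "\<forall>\<^sub>F p in net_filter I le.
        norm (wnorm w (\<lambda>x. b x * e p x - b x)) \<le> sqrt (\<delta> (snd p)) * W"
      unfolding eventually_net_filter[OF dir] using i by blast
    have "filterlim snd sequentially (net_filter I le)"
      unfolding filterlim_at_top
    proof
      fix n
      have "({}, n) \<in> I" by (simp add: I_def)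
      moreover have "\<forall>p\<in>I. le ({}, n) p \<longrightarrow> n \<le> snd p" by (simp add: le_def)
      ultimately show "\<forall>\<^sub>F p in net_filter I le. n \<le> snd p"
        unfolding eventually_net_filter[OF dir] by blast
    qed
    moreover have "(\<lambda>n. sqrt (\<delta> n) * W) \<longlonglongrightarrow> 0"
      unfolding \<delta>_def
      using tendsto_mult_right[OF tendsto_real_sqrt[OF LIMSEQ_inverse_real_of_nat], of W] by simp
    ultimately show "((\<lambda>p. sqrt (\<delta> (snd p)) * W) \<longlongrightarrow> 0) (net_filter I le)"
      using filterlim_compose by blast
  qed
  have "bounded_approx_identity (wnorm w) E I le e"
    unfolding bounded_approx_identity_def using dir eE bound conv by blast
  then show ?thesis by (rule has_bounded_approx_identityI)
qed

section \<open>Weak approximate identities bound the weight\<close>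

lemma evaluation_character:
  assumes "f \<in> A" "f x \<noteq> 0"
  shows "evaluation x \<in> characters A"
  using assms unfolding characters_def evaluation_def by auto

text \<open>
  From \<open>a(x) e\<^sub>i(x) \<rightarrow> a(x) \<noteq> 0\<close> one gets \<open>e\<^sub>i(x) \<rightarrow> 1\<close>; pass to the limit in
  \<open>cmod (e\<^sub>i(x)) * w(x) \<le> M\<close>. The bound \<open>M\<close> does not depend on \<open>x\<close>.
\<close>

lemma bounded_weak_approx_identity_weight_le:
  assumes usc: "upper_semicontinuous w" and w: "\<And>x. w x \<ge> 1" and E: "E \<subseteq> C0w w"
    and bwai: "bounded_weak_approx_identity (wnorm w) (C0w w) E I le e"
    and M: "\<And>i. i \<in> I \<Longrightarrow> wnorm w (e i) \<le> M"
    and a: "a \<in> E" "a x \<noteq> 0"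
  shows "w x \<le> M"
proof -
  let ?F = "net_filter I le"
  have dir: "directed_set I le" and eE: "\<And>i. i \<in> I \<Longrightarrow> e i \<in> E"
    using bwai unfolding bounded_weak_approx_identity_def by auto
  obtain i0 where i0: "i0 \<in> I" using dir unfolding directed_set_def by blast
  have "evaluation x \<in> characters (C0w w)"
    using a E by (intro evaluation_character[of a]) auto
  then have "((\<lambda>i. cmod (evaluation x (\<lambda>x. a x * e i x) - evaluation x a)) \<longlongrightarrow> 0) ?F"
    using bwai a(1) unfolding bounded_weak_approx_identity_def by blast
  then have "((\<lambda>i. cmod (a x * e i x - a x)) \<longlongrightarrow> 0) ?F"
    unfolding evaluation_def .
  then have "((\<lambda>i. a x * e i x - a x) \<longlongrightarrow> 0) ?F" by (rule tendsto_norm_zero_cancel)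
  then have "((\<lambda>i. inverse (a x) * (a x * e i x - a x) + 1) \<longlongrightarrow> inverse (a x) * 0 + 1) ?F"
    by (intro tendsto_intros)
  moreover have "inverse (a x) * (a x * e i x - a x) + 1 = e i x" for i
    using a(2) by (simp add: field_simps)
  ultimately have "((\<lambda>i. e i x) \<longlongrightarrow> 1) ?F" by simp
  then have lim: "((\<lambda>i. cmod (e i x) * w x) \<longlongrightarrow> cmod 1 * w x) ?F"
    by (intro tendsto_intros)
  have "cmod (e i x) * w x \<le> M" if i: "i \<in> I" for i
    using wnorm_ge[OF usc, of "e i" x] eE[OF i] E M[OF i] by force
  then have "\<forall>\<^sub>F i in ?F. cmod (e i x) * w x \<le> M"
    unfolding eventually_net_filter[OF dir] using i0 by blast
  moreover have "?F \<noteq> bot"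
    using dir unfolding trivial_limit_def eventually_net_filter[OF dir] directed_set_def by blast
  ultimately show ?thesis using tendsto_upperbound[OF lim] by simp
qed

text \<open>
  One exceptional point costs nothing, since \<open>w\<close> takes a single finite value there. The kernel of
  evaluation at \<open>t\<close> has such a point, namely \<open>t\<close> itself.
\<close>

lemma weak_approx_identity_imp_bounded_weight:
  assumes usc: "upper_semicontinuous w" and w: "\<And>x. w x \<ge> 1" and E: "E \<subseteq> C0w w"
    and has: "has_bounded_weak_approx_identity (wnorm w) (C0w w) E"
    and sep: "\<And>x. x \<noteq> t \<Longrightarrow> \<exists>a\<in>E. a x \<noteq> 0"
  shows "bounded (range w)"
proof -
  obtain I le e where bwai: "bounded_weak_approx_identity (wnorm w) (C0w w) E
      (I :: 'a fun_net_index set) le e"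
    using has unfolding has_bounded_weak_approx_identity_def by blast
  then obtain M where M: "\<And>i. i \<in> I \<Longrightarrow> wnorm w (e i) \<le> M"
    unfolding bounded_weak_approx_identity_def by blast
  have "w x \<le> max M (w t)" for x
  proof (cases "x = t")
    case False
    then obtain a where a: "a \<in> E" "a x \<noteq> 0" using sep by blast
    have "w x \<le> M"
      by (rule bounded_weak_approx_identity_weight_le[OF usc w E bwai M a])
    then show ?thesis by simp
  qed simp
  then have "norm (w x) \<le> max M (w t)" for x using w[of x] by simp
  then show ?thesis by (intro boundedI) auto
qed

lemma C0w_compact_support:
  assumes "continuous_on UNIV f" "compact K" "\<And>x. x \<notin> K \<Longrightarrow> f x = 0"
  shows "f \<in> C0w w"
  using assms by (intro C0wI_vanishing) auto

text \<open>
  Cutting \<open>V\<close> down to a neighbourhood of \<open>x\<close> contained in a compact set \<open>K\<close> makes the Urysohn function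
  vanish off \<open>K\<close>, and a continuous function with compact support belongs to the algebra of any weight.
\<close>

lemma C0w_bump:
  fixes x :: "'a::t2_space" and w :: "'a \<Rightarrow> real"
  assumes lc: "locally_compact_space (euclidean :: 'a topology)" and V: "open V" "x \<in> V"
  obtains a where "a \<in> C0w w" "a x \<noteq> 0" "\<And>y. y \<notin> V \<Longrightarrow> a y = 0"
proof -
  obtain U K where UK: "open U" "compact K" "x \<in> U" "U \<subseteq> K"
    using lc unfolding locally_compact_space_def by simp metis
  have haus: "Hausdorff_space (euclidean :: 'a topology)"
    unfolding Hausdorff_space_def disjnt_def using hausdorff by fastforce
  have "completely_regular_space (euclidean :: 'a topology)"
    using lc haus
    by (simp add: locally_compact_regular_imp_completely_regular_space
        locally_compact_Hausdorff_imp_regular_space)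
  moreover have "closedin euclidean (- (U \<inter> V))" "x \<in> topspace euclidean - (- (U \<inter> V))"
    using UK V by (auto simp: closed_Compl open_Int)
  ultimately obtain f :: "'a \<Rightarrow> real"
    where f: "continuous_map euclidean (top_of_set {0..1}) f" "f x = 0" "f ` (- (U \<inter> V)) \<subseteq> {1}"
    unfolding completely_regular_space_def by blast
  have cont: "continuous_on UNIV f"
    using f(1) by (simp add: continuous_map_in_subtopology)
  have off: "f y = 1" if "y \<notin> U \<inter> V" for y using f(3) that by auto
  show thesis
  proof (rule that)
    show "(\<lambda>y. complex_of_real (1 - f y)) \<in> C0w w"
    proof (rule C0w_compact_support[OF _ UK(2)])
      show "continuous_on UNIV (\<lambda>y. complex_of_real (1 - f y))"
        by (intro continuous_intros cont)
      show "complex_of_real (1 - f y) = 0" if "y \<notin> K" for y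
        using off[of y] that UK(4) by auto
    qed
  qed (use f(2) off in auto)
qed

section \<open>The equivalence\<close>

theorem theorem7:
  fixes w :: "'a::{topological_group_add, t2_space} \<Rightarrow> real" and t :: 'a
  assumes "locally_compact_space (euclidean :: 'a topology)"
    and "upper_semicontinuous w"
    and "\<And>x. w x \<ge> 1"
  shows "(has_bounded_approx_identity (wnorm w) (character_kernel (C0w w) (evaluation t)) \<longleftrightarrow>
          has_bounded_weak_approx_identity (wnorm w) (C0w w) (character_kernel (C0w w) (evaluation t))) \<and>
         (has_bounded_weak_approx_identity (wnorm w) (C0w w) (character_kernel (C0w w) (evaluation t)) \<longleftrightarrow>
          has_bounded_weak_approx_identity (wnorm w) (C0w w) (C0w w)) \<and>
         (has_bounded_weak_approx_identity (wnorm w) (C0w w) (C0w w) \<longleftrightarrow>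
          bounded (range w))"
proof -
  let ?A = "C0w w" and ?k = "character_kernel (C0w w) (evaluation t)"
  have kA: "?k \<subseteq> ?A" unfolding character_kernel_def by blast
  have weak: "has_bounded_weak_approx_identity (wnorm w) ?A E"
    if "has_bounded_approx_identity (wnorm w) E" "E \<subseteq> ?A" for E
    using that bounded_approx_identity_imp_weak[OF assms(2,3) that(2)]
    unfolding has_bounded_approx_identity_def has_bounded_weak_approx_identity_def by blast
  have k_bai: "has_bounded_approx_identity (wnorm w) ?k" if "bounded (range w)"
    by (rule bounded_weight_imp_has_bounded_approx_identity[OF assms(2,3) kA _ that])
      (auto simp: character_kernel_def evaluation_def)
  have A_bai: "has_bounded_approx_identity (wnorm w) ?A" if "bounded (range w)"
    by (rule bounded_weight_imp_has_bounded_approx_identity[OF assms(2,3) subset_refl _ that])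
  have k_sep: "\<exists>a\<in>?k. a x \<noteq> 0" if x: "x \<noteq> t" for x
  proof -
    have "open (- {t})" "x \<in> - {t}" using x by auto
    then obtain a where "a \<in> ?A" "a x \<noteq> 0" "\<And>y. y \<notin> - {t} \<Longrightarrow> a y = 0"
      by (rule C0w_bump[OF assms(1)]) (rule that)
    then show ?thesis unfolding character_kernel_def evaluation_def by auto
  qed
  have k_bdd: "bounded (range w)" if "has_bounded_weak_approx_identity (wnorm w) ?A ?k"
    by (rule weak_approx_identity_imp_bounded_weight[OF assms(2,3) kA that k_sep])
  have A_bdd: "bounded (range w)" if "has_bounded_weak_approx_identity (wnorm w) ?A ?A"
    by (rule weak_approx_identity_imp_bounded_weight[OF assms(2,3) subset_refl that, of t])
      (use k_sep kA in blast)
  show ?thesis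
    using weak[OF _ kA] weak[OF _ subset_refl] k_bai A_bai k_bdd A_bdd by blast
qed

end
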